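(* Let $I\subseteq J$ be ideals of a commutative ring $R$ such that the canonical map $\operatorname{Max}(R/J)\rightarrow\operatorname{Max}(R/I)$ is surjective. If $J$ is a lifting ideal of $R$, then $I$ is a lifting ideal of $R$.
   Context: All rings are commutative with $1$. $\operatorname{Max}(A)$ denotes the set of maximal ideals of a ring $A$; the canonical map $\operatorname{Max}(R/J)\rightarrow\operatorname{Max}(R/I)$ is given by taking preimages under the canonical surjection $R/I\rightarrow R/J$. An ideal $I$ of a ring $R$ is called a lifting ideal of $R$ if every idempotent of $R/I$ is the image of an idempotent of $R$; equivalently, whenever $f\in R$ satisfies $f-f^{2}\in I$, there exists an idempotent $e\in R$ with $f-e\in I$. *)

theory Defs
  imports "HOL-Algebra.QuotRing"
begin

definition max_spec :: "('a, 'b) ring_scheme \<Rightarrow> 'a set set" where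
  "max_spec A = {M. maximalideal M A}"

definition idempotents :: "('a, 'b) ring_scheme \<Rightarrow> 'a set" where
  "idempotents A = {e \<in> carrier A. e \<otimes>\<^bsub>A\<^esub> e = e}"

definition lifting_ideal :: "'a set \<Rightarrow> ('a, 'b) ring_scheme \<Rightarrow> bool" where
  "lifting_ideal I R \<longleftrightarrow>
     ideal I R \<and> (\<forall>E \<in> idempotents (R Quot I). \<exists>e \<in> idempotents R. I +>\<^bsub>R\<^esub> e = E)"

text \<open>The canonical surjection \<open>R Quot I \<rightarrow> R Quot J\<close> for ideals \<open>I \<subseteq> J\<close>. On a coset \<open>I +> a\<close> all the
  cosets in the union coincide with \<open>J +> a\<close>, see \<open>quot_surj_coset\<close>; the ideal \<open>I\<close> enters only
  through the domain.\<close>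

definition quot_surj :: "('a, 'b) ring_scheme \<Rightarrow> 'a set \<Rightarrow> 'a set \<Rightarrow> 'a set" where
  "quot_surj R J X = (\<Union>x\<in>X. J +>\<^bsub>R\<^esub> x)"

definition max_spec_map ::
    "('a, 'b) ring_scheme \<Rightarrow> 'a set \<Rightarrow> 'a set \<Rightarrow> 'a set set \<Rightarrow> 'a set set" where
  "max_spec_map R I J N = {X \<in> carrier (R Quot I). quot_surj R J X \<in> N}"

lemma quot_surj_coset:
  fixes R (structure)
  assumes "ideal I R" "ideal J R" "I \<subseteq> J" "a \<in> carrier R"
  shows "quot_surj R J (I +> a) = J +> a"
proof -
  interpret I: ideal I R by fact
  interpret J: ideal J R by fact
  have eq: "J +> (i \<oplus> a) = J +> a" if "i \<in> I" for i
  proof -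
    have "i \<in> J" using that assms(3) by blast
    hence "i \<oplus> a \<in> J +> a" by (auto simp: a_r_coset_def')
    thus ?thesis using I.a_repr_independence[OF _ assms(4) J.a_subgroup] by simp
  qed
  have "I +> a = (\<lambda>i. i \<oplus> a) ` I" by (auto simp: a_r_coset_def')
  moreover have "I \<noteq> {}" using additive_subgroup.zero_closed[OF ideal.axioms(1)[OF assms(1)]] by blast
  ultimately show ?thesis by (auto simp: quot_surj_def eq)
qed

lemma quot_surj_ring_hom:
  fixes R (structure)
  assumes "ideal I R" "ideal J R" "I \<subseteq> J"
  shows "ring_hom_ring (R Quot I) (R Quot J) (quot_surj R J)"
proof -
  have R: "ring R" using assms(1) by (rule ideal.axioms(2))
  note hI = ideal.rcos_ring_hom[OF assms(1)] and hJ = ideal.rcos_ring_hom[OF assms(2)]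
  note ev = quot_surj_coset[OF assms]
  have rep: "\<exists>a\<in>carrier R. X = I +> a" if "X \<in> carrier (R Quot I)" for X
    using that by (auto simp: FactRing_def A_RCOSETS_def')
  show ?thesis
  proof (rule ring_hom_ringI)
    show "ring (R Quot I)" "ring (R Quot J)"
      using assms by (simp_all add: ideal.quotient_is_ring)
  next
    fix X assume "X \<in> carrier (R Quot I)"
    then obtain a where a: "a \<in> carrier R" "X = I +> a"
      using rep by blast
    show "quot_surj R J X \<in> carrier (R Quot J)"
      unfolding a(2) ev[OF a(1)] by (rule ring_hom_closed[OF hJ a(1)])
  next
    fix X Y assume "X \<in> carrier (R Quot I)" "Y \<in> carrier (R Quot I)"
    then obtain a b where ab: "a \<in> carrier R" "b \<in> carrier R" and X: "X = I +> a" and Y: "Y = I +> b"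
      using rep by meson
    have "a \<otimes> b \<in> carrier R" "a \<oplus> b \<in> carrier R"
      using ab R by (simp_all add: ring.ring_simprules)
    note ev' = ev[OF ab(1)] ev[OF ab(2)] this[THEN ev]
    show "quot_surj R J (X \<otimes>\<^bsub>R Quot I\<^esub> Y) = quot_surj R J X \<otimes>\<^bsub>R Quot J\<^esub> quot_surj R J Y"
      unfolding X Y ring_hom_mult[OF hI ab, symmetric] ev' by (rule ring_hom_mult[OF hJ ab])
    show "quot_surj R J (X \<oplus>\<^bsub>R Quot I\<^esub> Y) = quot_surj R J X \<oplus>\<^bsub>R Quot J\<^esub> quot_surj R J Y"
      unfolding X Y ring_hom_add[OF hI ab, symmetric] ev' by (rule ring_hom_add[OF hJ ab])
  next
    show "quot_surj R J \<one>\<^bsub>R Quot I\<^esub> = \<one>\<^bsub>R Quot J\<^esub>"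
      unfolding ring_hom_one[OF hI, symmetric] ev[OF ring.ring_simprules(6)[OF R]]
      by (rule ring_hom_one[OF hJ])
  qed
qed

lemma quot_surj_image:
  fixes R (structure)
  assumes "ideal I R" "ideal J R" "I \<subseteq> J"
  shows "quot_surj R J ` carrier (R Quot I) = carrier (R Quot J)"
proof -
  have "carrier (R Quot K) = (\<lambda>a. K +> a) ` carrier R" for K
    by (auto simp: FactRing_def A_RCOSETS_def')
  then show ?thesis
    by (simp add: image_image quot_surj_coset[OF assms])
qed

end

theory Submission
  imports Defs "HOL-Algebra.Ring_Divisibility"
begin

text \<open>Surjectivity on maximal spectra says that \<open>J/I\<close> lies in the Jacobson radical of \<open>R/I\<close>.
  Given an idempotent \<open>E\<close> of \<open>R/I\<close>, lift its image in \<open>R/J\<close> to an idempotent \<open>e\<close> of \<open>R\<close>. Then \<open>E\<close> and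
  the class of \<open>e\<close> are idempotents of \<open>R/I\<close> that are congruent modulo the Jacobson radical, and such
  idempotents \<open>x\<close>, \<open>y\<close> are equal: \<open>x - xy\<close> and \<open>y - xy\<close> are idempotents in the Jacobson radical, and such
  an idempotent \<open>a\<close> vanishes because \<open>1 - a\<close> is a unit killing it.\<close>

text \<open>Zorn's lemma applies to the ideals that contain \<open>K\<close> and omit
  \<open>\<one>\<close>. Properness is phrased as omitting \<open>\<one>\<close> because this form
  passes at once to the union of a chain.\<close>

lemma (in ring) exists_maximalideal:
  assumes K: "ideal K R" and "\<one> \<notin> K"
  obtains M where "maximalideal M R" "K \<subseteq> M"
proof -
  define S where "S = {L. ideal L R \<and> K \<subseteq> L \<and> \<one> \<notin> L}"
  have "K \<in> S"
    using assms by (simp add: S_def)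
  have "\<exists>M\<in>S. \<forall>L\<in>S. M \<subseteq> L \<longrightarrow> L = M"
  proof (rule subset_Zorn_nonempty)
    show "S \<noteq> {}"
      using \<open>K \<in> S\<close> by blast
    fix C assume "C \<noteq> {}" and C: "subset.chain S C"
    then have "C \<subseteq> S" and "subset.chain {L. ideal L R} C"
      by (auto simp: pred_on.chain_def S_def)
    then have "ideal (\<Union>C) R"
      using chain_Union_is_ideal[of C] \<open>C \<noteq> {}\<close> by simp
    then show "\<Union>C \<in> S"
      using \<open>C \<subseteq> S\<close> \<open>C \<noteq> {}\<close> by (auto simp: S_def)
  qed
  then obtain M where "M \<in> S" and max: "\<And>L. L \<in> S \<Longrightarrow> M \<subseteq> L \<Longrightarrow> L = M"
    by blast
  then have M: "ideal M R" "K \<subseteq> M" "\<one> \<notin> M"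
    by (auto simp: S_def)
  have "maximalideal M R"
  proof (rule maximalidealI[OF M(1)])
    show "carrier R \<noteq> M"
      using M(3) by blast
    fix L assume L: "ideal L R" "M \<subseteq> L"
    show "L = M \<or> L = carrier R"
    proof (cases "\<one> \<in> L")
      case True
      then show ?thesis using ideal.one_imp_carrier[OF L(1)] by simp
    next
      case False
      then have "L \<in> S" using L M by (auto simp: S_def)
      then show ?thesis using max L by blast
    qed
  qed
  then show ?thesis
    using M(2) that by blast
qed

lemma (in cring) idempotent_in_maximal_ideals_eq_zero:
  assumes a: "a \<in> idempotents R" and max: "\<And>M. maximalideal M R \<Longrightarrow> a \<in> M"
  shows "a = \<zero>"
proof -
  have ac: "a \<in> carrier R" and aa: "a \<otimes> a = a"
    using a by (simp_all add: idempotents_def)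
  define u where "u = \<one> \<ominus> a"
  have uc: "u \<in> carrier R" and au: "a \<otimes> u = \<zero>" and one: "u \<oplus> a = \<one>"
    using ac aa by (simp_all add: u_def minus_eq r_distr r_minus r_neg a_assoc l_neg)
  \<comment> \<open>\<open>u\<close> is a unit: a maximal ideal containing \<open>u\<close> would
    also contain \<open>a\<close>, hence \<open>u \<oplus> a = \<one>\<close>.\<close>
  have "\<one> \<in> PIdl u"
  proof (rule ccontr)
    assume "\<one> \<notin> PIdl u"
    then obtain M where M: "maximalideal M R" "PIdl u \<subseteq> M"
      using exists_maximalideal[OF cgenideal_ideal[OF uc]] by blast
    interpret M: maximalideal M R by fact
    have "u \<in> M" "a \<in> M"
      using cgenideal_self[OF uc] M max by auto
    then have "\<one> \<in> M"
      using M.a_closed one by metis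
    then show False
      using M.one_imp_carrier M.I_notcarr by simp
  qed
  then obtain r where r: "r \<in> carrier R" "\<one> = r \<otimes> u"
    by (auto simp: cgenideal_def)
  have "a = a \<otimes> (r \<otimes> u)"
    using ac by (simp flip: r(2))
  also have "\<dots> = r \<otimes> (a \<otimes> u)"
    using ac r(1) uc by (simp add: m_lcomm)
  finally show ?thesis
    using au r(1) by simp
qed

lemma (in cring) idempotents_cong_maximal_ideals_eq:
  assumes x: "x \<in> idempotents R" and y: "y \<in> idempotents R"
    and max: "\<And>M. maximalideal M R \<Longrightarrow> x \<ominus> y \<in> M"
  shows "x = y"
proof -
  have c: "x \<in> carrier R" "x \<otimes> x = x" "y \<in> carrier R" "y \<otimes> y = y"
    using x y by (simp_all add: idempotents_def)
  \<comment> \<open>Stated for arbitrary \<open>v\<close> and \<open>w\<close> so that it can be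
    applied to \<open>x\<close>, \<open>y\<close> in both orders.\<close>
  have absorb: "v = v \<otimes> w"
    if v: "v \<in> carrier R" "v \<otimes> v = v" and w: "w \<in> carrier R" "w \<otimes> w = w"
      and max': "\<And>M. maximalideal M R \<Longrightarrow> v \<ominus> w \<in> M" for v w
  proof -
    \<comment> \<open>This factorization puts \<open>v \<ominus> v \<otimes> w\<close> into every
      maximal ideal, as each of them contains \<open>v \<ominus> w\<close>.\<close>
    have eq: "v \<otimes> (v \<ominus> w) = v \<ominus> v \<otimes> w"
      using v w by (simp add: minus_eq r_distr r_minus)
    \<comment> \<open>In the expanded square of \<open>v \<ominus> v \<otimes> w\<close>, the two
      mixed products and the square of \<open>v \<otimes> w\<close> all equal
      \<open>v \<otimes> w\<close>, so one copy remains subtracted.\<close>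
    have "v \<otimes> (v \<otimes> w) = v \<otimes> w" "v \<otimes> w \<otimes> (v \<otimes> w) = v \<otimes> w"
      using v w by (metis m_assoc, metis m_assoc m_comm m_closed)
    then have "(v \<ominus> v \<otimes> w) \<otimes> (v \<ominus> v \<otimes> w) = v \<ominus> v \<otimes> w"
      using v w m_comm[of "v \<otimes> w" v]
      by (simp add: minus_eq r_distr l_distr r_minus l_minus r_neg l_neg a_assoc)
    then have "v \<ominus> v \<otimes> w \<in> idempotents R"
      using v w by (simp add: idempotents_def)
    moreover have "v \<ominus> v \<otimes> w \<in> M" if "maximalideal M R" for M
      using ideal.I_l_closed[OF maximalideal.axioms(1)[OF that] max'[OF that] v(1)] by (simp add: eq)
    ultimately have "v \<ominus> v \<otimes> w = \<zero>"
      by (rule idempotent_in_maximal_ideals_eq_zero)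
    then show ?thesis
      using v w by simp
  qed
  have "y \<ominus> x \<in> M" if "maximalideal M R" for M
  proof -
    interpret M: maximalideal M R by fact
    have "y \<ominus> x = \<ominus> (x \<ominus> y)"
      using c by (simp add: minus_eq minus_add a_comm)
    then show ?thesis
      using max[OF that] M.a_inv_closed by simp
  qed
  then have "x = x \<otimes> y" "y = y \<otimes> x"
    using absorb c max by blast+
  then show ?thesis
    using c m_comm by metis
qed

lemma idempotents_hom:
  assumes "h \<in> ring_hom A B" "e \<in> idempotents A"
  shows "h e \<in> idempotents B"
  using assms ring_hom_closed[of h A B e] ring_hom_mult[of h A B e e]
  by (simp add: idempotents_def)

text \<open>By surjectivity \<open>N\<close> is the preimage of an ideal of \<open>R Quot J\<close>,
  and such a preimage contains the kernel J/I. This is how J/I ends up in the Jacobson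
  radical.\<close>

lemma quot_surj_kernel_mem_maximalideal:
  fixes R (structure)
  assumes surj: "max_spec_map R I J ` max_spec (R Quot J) = max_spec (R Quot I)"
    and X: "X \<in> carrier (R Quot I)" "quot_surj R J X = \<zero>\<^bsub>R Quot J\<^esub>"
    and N: "maximalideal N (R Quot I)"
  shows "X \<in> N"
proof -
  obtain N' where N': "maximalideal N' (R Quot J)" "N = max_spec_map R I J N'"
    using N surj by (auto simp: max_spec_def)
  interpret N': maximalideal N' "R Quot J" by fact
  show ?thesis
    using X N'.zero_closed by (simp add: N'(2) max_spec_map_def)
qed

theorem proposition3p9:
  fixes R :: "('a, 'b) ring_scheme" (structure) and I J :: "'a set"
  assumes "cring R"
    and "ideal I R" and "ideal J R" and "I \<subseteq> J"
    and "max_spec_map R I J ` max_spec (R Quot J) = max_spec (R Quot I)"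
    and "lifting_ideal J R"
  shows "lifting_ideal I R"
  unfolding lifting_ideal_def
proof (intro conjI ballI)
  show "ideal I R" by fact
  fix E assume E: "E \<in> idempotents (R Quot I)"
  interpret I: ideal I R by fact
  interpret Q: cring "R Quot I" by (rule I.quotient_is_cring[OF assms(1)])
  interpret q: ring_hom_ring "R Quot I" "R Quot J" "quot_surj R J"
    by (rule quot_surj_ring_hom[OF assms(2-4)])
  have "quot_surj R J E \<in> idempotents (R Quot J)"
    using idempotents_hom[OF q.homh E] .
  then obtain e where e: "e \<in> idempotents R" "J +> e = quot_surj R J E"
    using assms(6) by (auto simp: lifting_ideal_def)
  have Ie: "I +> e \<in> idempotents (R Quot I)"
    using idempotents_hom[OF I.rcos_ring_hom e(1)] .
  have c: "I +> e \<in> carrier (R Quot I)" "E \<in> carrier (R Quot I)"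
    using Ie E by (simp_all add: idempotents_def)
  \<comment> \<open>Both sides are \<open>J +> e\<close>, so the difference of the two idempotents
    lies in the kernel and hence in every maximal ideal of \<open>R Quot I\<close>.\<close>
  have "quot_surj R J (I +> e) = quot_surj R J E"
    using quot_surj_coset[OF assms(2-4), of e] e by (simp add: idempotents_def)
  then have "quot_surj R J ((I +> e) \<ominus>\<^bsub>R Quot I\<^esub> E) = \<zero>\<^bsub>R Quot J\<^esub>"
    using c by (simp add: Q.minus_eq q.S.r_neg)
  then have "I +> e = E"
    using Q.idempotents_cong_maximal_ideals_eq[OF Ie E]
      quot_surj_kernel_mem_maximalideal[OF assms(5)] c by blast
  then show "\<exists>e\<in>idempotents R. I +> e = E"
    using e(1) by blast
qed

end
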